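(* Let $\omega(x,y)=-\omega(y,x)$ be a skew-symmetric kernel and $\rho$ a weight function on $\mathbb{R}$ such that the integrals $$\mu_{i,j}^{k,l}=\iint_{\mathbb{R}^2}x^{k-i}y^{k-j}(1+x)^l(1+y)^l\omega(x,y)\rho(x)\rho(y)\,dx\,dy,\qquad \beta_i^{k,l}=\int_{\mathbb{R}}x^{k-i}(1+x)^l\rho(x)\,dx$$ converge absolutely for all integers $i,j,k$ and all integers $l\ge 0$. Put $$\tau_{2n}^{k,l}=Pf(0,1,\dots,2n-1)^{k,l},\qquad \tau_{2n+1}^{k,l}=Pf(d_0,0,1,\dots,2n)^{k,l},$$ with Pfaffian entries $Pf(i,j)^{k,l}=\mu_{i,j}^{k,l}$, $Pf(d_0,i)^{k,l}=\beta_i^{k,l}$, and assume all $\tau_n^{k,l}$ ($n,k,l\ge 0$) are nonzero. Then for all integers $n\ge 0$, $k\ge 2$, $l\ge 0$, $$\tau_{n+2}^{k,l}\,\tau_{n-1}^{k-2,l+1}=\tau_{n+1}^{k,l}\,\tau_n^{k-2,l+1}-\tau_{n+1}^{k-1,l+1}\,\tau_n^{k-1,l}+\tau_{n+1}^{k-1,l}\,\tau_n^{k-1,l+1}.$$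
   Context: Hirota's Pfaffian notation: given symbols $a_1,\dots,a_{2N}$ and prescribed entries $Pf(a_i,a_j)=-Pf(a_j,a_i)$, $Pf(a_1,\dots,a_{2N})$ denotes the Pfaffian of the $2N\times 2N$ skew-symmetric matrix with $(i,j)$ entry $Pf(a_i,a_j)$; the empty Pfaffian is $1$. Superscripts on $Pf$ indicate that the entries with those superscripts are used. Conventions: $\tau_0^{k,l}=1$, $\tau_{-1}^{k,l}=0$. *)

theory Defs
  imports "HOL-Analysis.Analysis" "HOL-Combinatorics.Permutations"
begin

text \<open>
  The Pfaffian of the skew-symmetric \<open>2N \<times> 2N\<close> matrix with entries \<open>A i j\<close>, \<open>i, j < 2N\<close>.
  Each perfect matching of the \<open>2N\<close> indices is counted \<open>2^N N!\<close> times by the sum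
  over permutations.
\<close>

definition pfaffian :: "nat \<Rightarrow> (nat \<Rightarrow> nat \<Rightarrow> real) \<Rightarrow> real" where
  "pfaffian N A =
     (\<Sum>\<sigma> | \<sigma> permutes {..<2 * N}.
        of_int (sign \<sigma>) * (\<Prod>m<N. A (\<sigma> (2 * m)) (\<sigma> (2 * m + 1)))) / (2 ^ N * fact N)"

text \<open>Hirota's notation; only lists of even length are meaningful.\<close>

definition Pf :: "('s \<Rightarrow> 's \<Rightarrow> real) \<Rightarrow> 's list \<Rightarrow> real" where
  "Pf entry as = pfaffian (length as div 2) (\<lambda>i j. entry (as ! i) (as ! j))"

text \<open>
  Exponents may be negative: \<open>0 powi m = 0\<close> for \<open>m < 0\<close>, which affects the
  integrands below only on Lebesgue null sets.
\<close>

definition mu_integrand ::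
  "(real \<Rightarrow> real \<Rightarrow> real) \<Rightarrow> (real \<Rightarrow> real) \<Rightarrow> int \<Rightarrow> int \<Rightarrow> int \<Rightarrow> nat \<Rightarrow> real \<times> real \<Rightarrow> real" where
  "mu_integrand \<omega> \<rho> i j k l = (\<lambda>(x, y).
     x powi (k - i) * y powi (k - j) * (1 + x) ^ l * (1 + y) ^ l * \<omega> x y * \<rho> x * \<rho> y)"

definition beta_integrand :: "(real \<Rightarrow> real) \<Rightarrow> int \<Rightarrow> int \<Rightarrow> nat \<Rightarrow> real \<Rightarrow> real" where
  "beta_integrand \<rho> i k l = (\<lambda>x. x powi (k - i) * (1 + x) ^ l * \<rho> x)"

definition mu ::
  "(real \<Rightarrow> real \<Rightarrow> real) \<Rightarrow> (real \<Rightarrow> real) \<Rightarrow> int \<Rightarrow> int \<Rightarrow> int \<Rightarrow> nat \<Rightarrow> real" where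
  "mu \<omega> \<rho> i j k l = integral\<^sup>L lebesgue (mu_integrand \<omega> \<rho> i j k l)"

definition beta :: "(real \<Rightarrow> real) \<Rightarrow> int \<Rightarrow> int \<Rightarrow> nat \<Rightarrow> real" where
  "beta \<rho> i k l = integral\<^sup>L lebesgue (beta_integrand \<rho> i k l)"

datatype pf_symbol = D0 | Idx int

fun pf_entry ::
  "(real \<Rightarrow> real \<Rightarrow> real) \<Rightarrow> (real \<Rightarrow> real) \<Rightarrow> int \<Rightarrow> nat \<Rightarrow> pf_symbol \<Rightarrow> pf_symbol \<Rightarrow> real" where
  "pf_entry \<omega> \<rho> k l (Idx i) (Idx j) = mu \<omega> \<rho> i j k l"
| "pf_entry \<omega> \<rho> k l D0 (Idx i) = beta \<rho> i k l"
| "pf_entry \<omega> \<rho> k l (Idx i) D0 = - beta \<rho> i k l"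
| "pf_entry \<omega> \<rho> k l D0 D0 = 0"

text \<open>The convention \<open>\<tau>\<^sub>-\<^sub>1 = 0\<close> is the case \<open>n < 0\<close>; \<open>\<tau>\<^sub>0 = 1\<close> is the empty Pfaffian.\<close>

definition tau ::
  "(real \<Rightarrow> real \<Rightarrow> real) \<Rightarrow> (real \<Rightarrow> real) \<Rightarrow> int \<Rightarrow> int \<Rightarrow> nat \<Rightarrow> real" where
  "tau \<omega> \<rho> n k l =
     (if n < 0 then 0
      else if even n then Pf (pf_entry \<omega> \<rho> k l) (map Idx [0..n - 1])
      else Pf (pf_entry \<omega> \<rho> k l) (D0 # map Idx [0..n - 1]))"

lemma tau_minus_one [simp]: "tau \<omega> \<rho> (-1) k l = 0"
  by (simp add: tau_def)

lemma tau_zero [simp]: "tau \<omega> \<rho> 0 k l = 1"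
  by (simp add: tau_def Pf_def pfaffian_def)

end

theory Submission
  imports Defs "Jordan_Normal_Form.Determinant"
begin

text \<open>
  Passing from \<open>k\<close> to \<open>k - 1\<close> shifts the moment indices by one, and raising \<open>l\<close> by one replaces
  each index \<open>i\<close> by the formal sum of \<open>i\<close> and \<open>i - 1\<close>. Introduce an auxiliary symbol \<open>c\<close> with
  \<open>Pf(c, i) = (-1)^i\<close> and \<open>Pf(c, d\<^sub>0) = 0\<close>: it pairs to zero with all these formal sums. Adding to
  each index in \<open>Pf(c, [d\<^sub>0,] a, \<dots>, b)\<close> but the first its predecessor and expanding along \<open>c\<close>
  leaves, up to sign, the Pfaffian of the formal sums. So every \<open>\<tau>\<close> in the theorem is a Pfaffian
  in the symbols \<open>c, d\<^sub>0, 0, \<dots>, n + 1\<close>, and the claim is the four-term quadratic (Pluecker)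
  relation for Pfaffians, with common part \<open>1, \<dots>, n\<close>.
\<close>

section \<open>Row expansion of the Pfaffian\<close>

definition pf_term :: "nat \<Rightarrow> (nat \<Rightarrow> nat \<Rightarrow> real) \<Rightarrow> (nat \<Rightarrow> nat) \<Rightarrow> real" where
  "pf_term N A \<sigma> = of_int (sign \<sigma>) * (\<Prod>m<N. A (\<sigma> (2 * m)) (\<sigma> (2 * m + 1)))"

lemma pfaffian_pf_term:
  "pfaffian N A = (\<Sum>\<sigma> | \<sigma> permutes {..<2 * N}. pf_term N A \<sigma>) / (2 ^ N * fact N)"
  by (simp add: pfaffian_def pf_term_def)

text \<open>Composition with \<open>t\<close> on the right is an involution of the permutations of
  \<open>S\<close>. It exchanges those taking the value \<open>c\<close> at \<open>p\<close> with
  those taking it at \<open>q\<close>.\<close>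

lemma sum_permutes_comp_involution:
  fixes f :: "(nat \<Rightarrow> nat) \<Rightarrow> real"
  assumes t: "t permutes S" and inv: "t \<circ> t = id"
    and f: "\<And>\<sigma>. \<sigma> permutes S \<Longrightarrow> f (\<sigma> \<circ> t) = f \<sigma>"
    and tp: "t p = q"
  shows "(\<Sum>\<sigma> | \<sigma> permutes S \<and> \<sigma> p = c. f \<sigma>) = (\<Sum>\<sigma> | \<sigma> permutes S \<and> \<sigma> q = c. f \<sigma>)"
proof -
  have tt: "t (t x) = x" for x
    using inv by (metis comp_apply id_apply)
  have cc: "\<sigma> \<circ> t \<circ> t = \<sigma>" for \<sigma> :: "nat \<Rightarrow> nat"
    by (simp add: comp_assoc inv)
  show ?thesis
    by (rule sum.reindex_bij_witness[where i = "\<lambda>\<sigma>. \<sigma> \<circ> t" and j = "\<lambda>\<sigma>. \<sigma> \<circ> t"])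
       (use tp tt[of p] in \<open>auto simp: cc f intro!: permutes_compose[OF t]\<close>)
qed

text \<open>The sign of the permutation and, by skew-symmetry, the factor of pair \<open>m\<close>
  both change sign.\<close>

lemma pf_term_comp_transpose_within_pair:
  assumes skew: "\<And>a b. A a b = - A b a" and m: "m < N" and s: "\<sigma> permutes {..<2 * N}"
  shows "pf_term N A (\<sigma> \<circ> Transposition.transpose (2 * m) (2 * m + 1)) = pf_term N A \<sigma>"
proof -
  let ?t = "Transposition.transpose (2 * m) (2 * m + 1)"
  have sg: "sign (\<sigma> \<circ> ?t) = - sign \<sigma>"
    using permutation_permutes s
    by (subst sign_compose) (auto simp: sign_swap_id permutation_swap_id)
  have e: "A ((\<sigma> \<circ> ?t) (2 * i)) ((\<sigma> \<circ> ?t) (2 * i + 1)) =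
      (if i = m then -1 else 1) * A (\<sigma> (2 * i)) (\<sigma> (2 * i + 1))" for i
  proof (cases "i = m")
    case True
    then show ?thesis using skew[of "\<sigma> (2*m+1)" "\<sigma> (2*m)"] by simp
  next
    case False
    then have "2 * i \<noteq> 2 * m" "2 * i \<noteq> 2 * m + 1" "2 * i + 1 \<noteq> 2 * m" "2 * i + 1 \<noteq> 2 * m + 1"
      by presburger+
    then show ?thesis using False by (simp add: Transposition.transpose_def)
  qed
  have "(\<Prod>i<N. (if i = m then -1 else 1 :: real)) = -1"
    using m by (simp add: prod.delta)
  then show ?thesis
    unfolding pf_term_def sg e prod.distrib by simp
qed

text \<open>Exchanging two whole pairs is an even permutation, and it only permutes the factors of
  the product.\<close>

lemma pf_term_comp_transpose_pairs:
  assumes m: "m < N" and s: "\<sigma> permutes {..<2 * N}"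
  shows "pf_term N A (\<sigma> \<circ> (Transposition.transpose 0 (2 * m) \<circ> Transposition.transpose 1 (2 * m + 1))) = pf_term N A \<sigma>"
proof -
  let ?t = "Transposition.transpose 0 (2 * m) \<circ> Transposition.transpose 1 (2 * m + 1)"
  have p: "permutation ?t"
    by (intro permutation_compose permutation_swap_id)
  have sg: "sign (\<sigma> \<circ> ?t) = sign \<sigma>"
    using permutation_permutes s p
    by (subst sign_compose) (auto simp: sign_compose permutation_swap_id sign_swap_id)
  let ?r = "Transposition.transpose 0 m"
  have e: "?t (2 * i) = 2 * ?r i" "?t (2 * i + 1) = 2 * ?r i + 1" for i
    by (auto simp: Transposition.transpose_def) presburger+
  have "(\<Prod>i<N. A (\<sigma> (2 * ?r i)) (\<sigma> (2 * ?r i + 1))) = (\<Prod>i<N. A (\<sigma> (2 * i)) (\<sigma> (2 * i + 1)))"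
    using m by (intro prod.reindex_bij_betw permutes_imp_bij permutes_swap_id) auto
  then show ?thesis
    unfolding pf_term_def sg by (simp only: o_apply[of \<sigma>] e)
qed

text \<open>The value \<open>c\<close> is first moved to the even position of its pair, and then
  that pair is exchanged with pair 0. Neither move changes the term.\<close>

lemma sum_pf_term_position:
  assumes skew: "\<And>a b. A a b = - A b a" and p: "p < 2 * N"
  shows "(\<Sum>\<sigma> | \<sigma> permutes {..<2 * N} \<and> \<sigma> p = c. pf_term N A \<sigma>) =
    (\<Sum>\<sigma> | \<sigma> permutes {..<2 * N} \<and> \<sigma> 0 = c. pf_term N A \<sigma>)"
proof -
  define m where "m = p div 2"
  have m: "m < N" using p unfolding m_def by auto
  let ?t = "Transposition.transpose 0 (2 * m) \<circ> Transposition.transpose 1 (2 * m + 1)"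
  have even: "(\<Sum>\<sigma> | \<sigma> permutes {..<2 * N} \<and> \<sigma> (2 * m) = c. pf_term N A \<sigma>) =
    (\<Sum>\<sigma> | \<sigma> permutes {..<2 * N} \<and> \<sigma> 0 = c. pf_term N A \<sigma>)"
  proof (rule sum_permutes_comp_involution)
    show "?t permutes {..<2 * N}"
      using m by (intro permutes_compose permutes_swap_id) auto
    show "?t \<circ> ?t = id"
      by (auto simp: fun_eq_iff Transposition.transpose_def)
    show "?t (2 * m) = 0"
      by (auto simp: Transposition.transpose_def)
  qed (rule pf_term_comp_transpose_pairs[OF m])
  show ?thesis
  proof (cases "even p")
    case True
    then show ?thesis using even unfolding m_def by simp
  next
    case False
    then have p2: "p = 2 * m + 1" unfolding m_def by presburger
    have "(\<Sum>\<sigma> | \<sigma> permutes {..<2 * N} \<and> \<sigma> p = c. pf_term N A \<sigma>) =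
      (\<Sum>\<sigma> | \<sigma> permutes {..<2 * N} \<and> \<sigma> (2 * m) = c. pf_term N A \<sigma>)"
    proof (rule sum_permutes_comp_involution)
      show "Transposition.transpose (2 * m) (2 * m + 1) permutes {..<2 * N}"
        using m by (intro permutes_swap_id) auto
    qed (use pf_term_comp_transpose_within_pair[OF skew m] p2 in \<open>auto simp: fun_eq_iff\<close>)
    then show ?thesis using even by simp
  qed
qed

section \<open>Permutations with a prescribed value at 0\<close>

lemma permutation_insert_0:
  "permutation_insert 0 j q 0 = j"
  "permutation_insert 0 j q (Suc i) = insert_index j (q i)"
  by (simp_all add: permutation_insert_def insert_dom_def insert_ran_def)

lemma sum_permutes_Suc:
  fixes f :: "(nat \<Rightarrow> nat) \<Rightarrow> real"
  assumes j: "j < Suc n"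
  shows "(\<Sum>\<sigma> | \<sigma> permutes {0..<Suc n} \<and> \<sigma> 0 = j. f \<sigma>) =
    (\<Sum>\<sigma> | \<sigma> permutes {0..<n}. f (permutation_insert 0 j \<sigma>))"
  by (subst permutation_fix[OF _ j], simp)
     (subst sum.reindex, use permutation_insert_inj_on[OF _ j, of 0] in auto)

lemma sign_permutation_insert:
  assumes "p permutes {0..<n}" and "j < Suc n"
  shows "real_of_int (sign (permutation_insert 0 j p)) = (-1) ^ j * of_int (sign p)"
  using signof_permutation_insert[OF assms(1) _ assms(2), of 0, where 'a = real] by simp

text \<open>Two values are stripped from a permutation: first the fixed point 0, then the partner of
  0. What remains permutes \<open>2 * N\<close> indices and loses only the sign
  \<open>(-1) ^ j\<close>, while the first pair contributes \<open>A 0 (Suc j)\<close>.\<close>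

lemma sum_pf_term_expand_row:
  "(\<Sum>\<sigma> | \<sigma> permutes {..<2 * Suc N} \<and> \<sigma> 0 = 0. pf_term (Suc N) A \<sigma>) =
   (\<Sum>j<Suc (2 * N). (-1) ^ j * A 0 (Suc j) *
      (\<Sum>\<sigma> | \<sigma> permutes {..<2 * N}.
        pf_term N (\<lambda>a b. A (Suc (insert_index j a)) (Suc (insert_index j b))) \<sigma>))"
proof -
  let ?n = "Suc (2 * N)"
  let ?ins = "permutation_insert 0"
  have "(\<Sum>\<sigma> | \<sigma> permutes {..<2 * Suc N} \<and> \<sigma> 0 = 0. pf_term (Suc N) A \<sigma>) =
    (\<Sum>\<sigma> | \<sigma> permutes {0..<?n}. pf_term (Suc N) A (?ins 0 \<sigma>))"
    using sum_permutes_Suc[of 0 ?n "pf_term (Suc N) A"] by (simp add: atLeast0LessThan)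
  \<comment> \<open>The terms are grouped by the value \<open>j\<close> of the stripped permutation
    at 0, so the partner of 0 in the original one is \<open>Suc j\<close>.\<close>
  also have "\<dots> = (\<Sum>j<?n. \<Sum>\<sigma> | \<sigma> \<in> {\<sigma>. \<sigma> permutes {0..<?n}} \<and> \<sigma> 0 = j.
      pf_term (Suc N) A (?ins 0 \<sigma>))"
  proof (rule sum.group[symmetric])
    show "(\<lambda>\<sigma>. \<sigma> 0) ` {\<sigma>. \<sigma> permutes {0..<?n}} \<subseteq> {..<?n}"
      using permutes_in_image by fastforce
  qed (auto intro: finite_permutations)
  also have "\<dots> = (\<Sum>j<?n. \<Sum>\<sigma> | \<sigma> permutes {0..<2 * N}. pf_term (Suc N) A (?ins 0 (?ins j \<sigma>)))"
    by (rule sum.cong[OF refl]) (simp add: sum_permutes_Suc)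
  also have "\<dots> = (\<Sum>j<?n. \<Sum>\<sigma> | \<sigma> permutes {0..<2 * N}. (-1) ^ j * A 0 (Suc j) *
        pf_term N (\<lambda>a b. A (Suc (insert_index j a)) (Suc (insert_index j b))) \<sigma>)"
  proof (intro sum.cong refl)
    fix j \<sigma> assume j: "j \<in> {..<?n}" and "\<sigma> \<in> {\<sigma>. \<sigma> permutes {0..<2 * N}}"
    then have s: "\<sigma> permutes {0..<2 * N}" and j: "j < ?n" by auto
    have s': "?ins j \<sigma> permutes {0..<?n}"
      by (rule permutation_insert_permutes[OF s _ j]) simp
    have sg: "real_of_int (sign (?ins 0 (?ins j \<sigma>))) = (-1) ^ j * of_int (sign \<sigma>)"
      using sign_permutation_insert[OF s' , of 0] sign_permutation_insert[OF s j] by simp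
    have 1: "?ins 0 (?ins j \<sigma>) 0 = 0" "?ins 0 (?ins j \<sigma>) (Suc 0) = Suc j"
      "?ins 0 (?ins j \<sigma>) (Suc (Suc i)) = Suc (insert_index j (\<sigma> i))" for i
      by (simp_all add: permutation_insert_0 insert_index_def)
    show "pf_term (Suc N) A (?ins 0 (?ins j \<sigma>)) = (-1) ^ j * A 0 (Suc j) *
        pf_term N (\<lambda>a b. A (Suc (insert_index j a)) (Suc (insert_index j b))) \<sigma>"
      unfolding pf_term_def prod.lessThan_Suc_shift sg by (simp add: 1)
  qed
  finally show ?thesis
    by (simp add: sum_distrib_left atLeast0LessThan)
qed

text \<open>Every permutation places the value 0 at exactly one of the \<open>2 * Suc N\<close>
  positions, and all positions contribute equally. The resulting factor \<open>2 * (N + 1)\<close>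
  turns the normalisation for \<open>Suc N\<close> into the one for \<open>N\<close>.\<close>

lemma pfaffian_expand_row:
  assumes skew: "\<And>a b. A a b = - A b a"
  shows "pfaffian (Suc N) A = (\<Sum>j<Suc (2 * N). (-1) ^ j * A 0 (Suc j) *
    pfaffian N (\<lambda>a b. A (Suc (insert_index j a)) (Suc (insert_index j b))))"
proof -
  let ?S = "{..<2 * Suc N}"
  let ?P = "{\<sigma>. \<sigma> permutes ?S}"
  have "(\<Sum>\<sigma> \<in> ?P. pf_term (Suc N) A \<sigma>) =
    (\<Sum>p<2 * Suc N. \<Sum>\<sigma> | \<sigma> \<in> ?P \<and> inv_into UNIV \<sigma> 0 = p. pf_term (Suc N) A \<sigma>)"
  proof (rule sum.group[symmetric])
    show "(\<lambda>\<sigma>. inv_into UNIV \<sigma> 0) ` ?P \<subseteq> ?S"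
    proof safe
      fix \<sigma> assume "\<sigma> permutes ?S"
      from permutes_inv[OF this] have "inv_into UNIV \<sigma> 0 \<in> ?S" using permutes_in_image by fastforce
      then show "inv_into UNIV \<sigma> 0 < 2 * Suc N" by simp
    qed
  qed (auto intro: finite_permutations)
  also have "\<dots> = (\<Sum>p<2 * Suc N. \<Sum>\<sigma> | \<sigma> permutes ?S \<and> \<sigma> p = 0. pf_term (Suc N) A \<sigma>)"
    by (intro sum.cong refl arg_cong[where f = Collect] ext) (auto simp: permutes_inv_eq)
  also have "\<dots> = (\<Sum>p<2 * Suc N. \<Sum>\<sigma> | \<sigma> permutes ?S \<and> \<sigma> 0 = 0. pf_term (Suc N) A \<sigma>)"
    by (intro sum.cong refl sum_pf_term_position[OF skew]) simp
  also have "\<dots> = 2 * (real N + 1) * (\<Sum>\<sigma> | \<sigma> permutes ?S \<and> \<sigma> 0 = 0. pf_term (Suc N) A \<sigma>)"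
    by simp
  finally have "pfaffian (Suc N) A =
    (2 * (real N + 1) * (\<Sum>\<sigma> | \<sigma> permutes ?S \<and> \<sigma> 0 = 0. pf_term (Suc N) A \<sigma>)) /
    (2 * (real N + 1) * (2 ^ N * fact N))"
    unfolding pfaffian_pf_term by (simp add: algebra_simps)
  then have "pfaffian (Suc N) A =
    (\<Sum>\<sigma> | \<sigma> permutes ?S \<and> \<sigma> 0 = 0. pf_term (Suc N) A \<sigma>) / (2 ^ N * fact N)"
    by (subst (asm) mult_divide_mult_cancel_left) (simp_all add: add_eq_0_iff)
  then show ?thesis
    unfolding sum_pf_term_expand_row pfaffian_pf_term[of N]
    by (subst (asm) sum_divide_distrib) (simp only: times_divide_eq_right)
qed

section \<open>Quadratic relations for Pfaffians of lists\<close>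

definition remove_nth :: "nat \<Rightarrow> 'a list \<Rightarrow> 'a list" where
  "remove_nth i xs = take i xs @ drop (Suc i) xs"

lemma length_remove_nth: "i < length xs \<Longrightarrow> length (remove_nth i xs) = length xs - 1"
  by (simp add: remove_nth_def)

lemma nth_remove_nth: "i < length xs \<Longrightarrow> Suc a < length xs \<Longrightarrow> remove_nth i xs ! a = xs ! insert_index i a"
  by (auto simp: remove_nth_def nth_append insert_index_def min_def)

lemma remove_nth_0 [simp]: "remove_nth 0 (x # xs) = xs"
  and remove_nth_Suc [simp]: "remove_nth (Suc i) (x # xs) = x # remove_nth i xs"
  and remove_nth_snoc_length [simp]: "remove_nth (length xs) (xs @ [x]) = xs"
  by (simp_all add: remove_nth_def)

section \<open>Dependence on the entries and expansion along the first symbol\<close>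

lemma pfaffian_cong:
  assumes "\<And>a b. a < 2 * N \<Longrightarrow> b < 2 * N \<Longrightarrow> A a b = B a b"
  shows "pfaffian N A = pfaffian N B"
proof -
  have "A (\<sigma> (2 * m)) (\<sigma> (2 * m + 1)) = B (\<sigma> (2 * m)) (\<sigma> (2 * m + 1))"
    if s: "\<sigma> permutes {..<2 * N}" and m: "m < N" for \<sigma> m
  proof -
    have "\<sigma> (2 * m) \<in> {..<2 * N}" "\<sigma> (2 * m + 1) \<in> {..<2 * N}"
      unfolding permutes_in_image[OF s] using m by auto
    then show ?thesis using assms by simp
  qed
  then show ?thesis
    by (simp add: pfaffian_def)
qed

lemma Pf_cong:
  assumes "\<And>x y. x \<in> set xs \<Longrightarrow> y \<in> set xs \<Longrightarrow> e x y = e' x y"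
  shows "Pf e xs = Pf e' xs"
  unfolding Pf_def
proof (rule pfaffian_cong)
  fix a b assume "a < 2 * (length xs div 2)" "b < 2 * (length xs div 2)"
  then have "a < length xs" "b < length xs" by auto
  then show "e (xs ! a) (xs ! b) = e' (xs ! a) (xs ! b)" by (simp add: assms)
qed

lemma Pf_map: "Pf e (map f xs) = Pf (\<lambda>x y. e (f x) (f y)) xs"
  unfolding Pf_def length_map
proof (rule pfaffian_cong)
  fix a b assume "a < 2 * (length xs div 2)" "b < 2 * (length xs div 2)"
  then have "a < length xs" "b < length xs" by auto
  then show "e (map f xs ! a) (map f xs ! b) = e (f (xs ! a)) (f (xs ! b))" by simp
qed

lemma Pf_Nil [simp]: "Pf e [] = 1"
  by (simp add: Pf_def pfaffian_def)

lemma Pf_Cons: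
  assumes skew: "\<And>x y. e x y = - e y x" and odd: "odd (length xs)"
  shows "Pf e (x # xs) = (\<Sum>j<length xs. (-1) ^ j * e x (xs ! j) * Pf e (remove_nth j xs))"
proof -
  obtain N where N: "length xs = Suc (2 * N)"
    using odd by (metis oddE Suc_eq_plus1)
  have "Pf e (x # xs) = pfaffian (Suc N) (\<lambda>i j. e ((x # xs) ! i) ((x # xs) ! j))"
    by (simp add: Pf_def N)
  also have "\<dots> = (\<Sum>j<Suc (2 * N). (-1) ^ j * e x (xs ! j) *
    pfaffian N (\<lambda>a b. e (xs ! insert_index j a) (xs ! insert_index j b)))"
    by (subst pfaffian_expand_row, rule skew) simp
  also have "\<dots> = (\<Sum>j<length xs. (-1) ^ j * e x (xs ! j) * Pf e (remove_nth j xs))"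
    unfolding N
  proof (intro sum.cong refl arg_cong2[where f = "(*)"])
    fix j assume "j \<in> {..<Suc (2 * N)}"
    then have j: "j < length xs" by (simp add: N)
    show "pfaffian N (\<lambda>a b. e (xs ! insert_index j a) (xs ! insert_index j b)) = Pf e (remove_nth j xs)"
      unfolding Pf_def length_remove_nth[OF j] N
      by (simp, rule pfaffian_cong) (simp add: nth_remove_nth[OF j] N)
  qed
  finally show ?thesis .
qed

section \<open>Alternation and additivity in the symbols\<close>

lemma Pf_transpose:
  assumes i: "i < length xs" and j: "j < length xs" and "i \<noteq> j" and even: "even (length xs)"
    and ys: "length ys = length xs" "\<And>a. a < length xs \<Longrightarrow> ys ! a = xs ! Transposition.transpose i j a"
  shows "Pf e ys = - Pf e xs"
proof -
  obtain N where N: "length xs = 2 * N" using even by auto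
  let ?t = "Transposition.transpose i j"
  let ?A = "\<lambda>a b. e (xs ! a) (xs ! b)"
  have t: "?t permutes {..<2 * N}"
    using i j by (intro permutes_swap_id) (auto simp: N)
  have "Pf e ys = pfaffian N (\<lambda>a b. ?A (?t a) (?t b))"
    unfolding Pf_def ys(1) N by (simp, rule pfaffian_cong) (simp add: ys N)
  also have "\<dots> = - pfaffian N ?A"
  proof -
    have sg: "sign (?t \<circ> \<sigma>) = - sign \<sigma>" if "\<sigma> permutes {..<2 * N}" for \<sigma>
      using that \<open>i \<noteq> j\<close> permutation_permutes
      by (subst sign_compose) (auto simp: sign_swap_id permutation_swap_id)
    \<comment> \<open>Reindexing by left composition turns the transposition of list positions into
      a change of the sign of \<sigma>.\<close>
    have "(\<Sum>\<sigma> | \<sigma> permutes {..<2 * N}. pf_term N ?A \<sigma>) =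
      (\<Sum>\<sigma> | \<sigma> permutes {..<2 * N}. pf_term N ?A (?t \<circ> \<sigma>))"
      by (rule setum_permutations_compose_left[OF t])
    also have "\<dots> = (\<Sum>\<sigma> | \<sigma> permutes {..<2 * N}. - pf_term N (\<lambda>a b. ?A (?t a) (?t b)) \<sigma>)"
      by (intro sum.cong refl) (simp add: pf_term_def sg)
    finally show ?thesis
      by (simp add: pfaffian_pf_term sum_negf)
  qed
  also have "pfaffian N ?A = Pf e xs"
    by (simp add: Pf_def N)
  finally show ?thesis .
qed

text \<open>Exchanging two equal symbols leaves the list unchanged but negates the Pfaffian.\<close>

lemma Pf_not_distinct:
  assumes even: "even (length xs)" and "\<not> distinct xs"
  shows "Pf e xs = 0"
proof -
  from assms(2) obtain i j where ij: "i < length xs" "j < length xs" "i \<noteq> j" "xs ! i = xs ! j"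
    by (auto simp: distinct_conv_nth)
  have "Pf e xs = - Pf e xs"
    by (rule Pf_transpose[OF ij(1-3) even refl]) (use ij in \<open>auto simp: Transposition.transpose_def\<close>)
  then show ?thesis by simp
qed

lemma Pf_swap_adjacent:
  assumes "even (length (us @ vs))"
  shows "Pf e (us @ y # x # vs) = - Pf e (us @ x # y # vs)"
proof (rule Pf_transpose[where i = "length us" and j = "Suc (length us)"])
  fix a
  consider "a < length us" | "a = length us" | "a = Suc (length us)" | "a > Suc (length us)"
    by linarith
  then show "(us @ y # x # vs) ! a = (us @ x # y # vs) ! Transposition.transpose (length us) (Suc (length us)) a"
  proof cases
    case 4
    then have "a - length us = Suc (Suc (a - length us - 2))" by simp
    with 4 show ?thesis by (simp add: nth_append Transposition.transpose_def)
  qed (auto simp: nth_append Transposition.transpose_def)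
qed (use assms in auto)

lemma Pf_move:
  assumes "even (length (us @ x # vs @ ws))"
  shows "Pf e (us @ x # vs @ ws) = (-1) ^ length vs * Pf e (us @ vs @ x # ws)"
  using assms
proof (induction vs arbitrary: us)
  case (Cons v vs)
  have "Pf e (us @ x # (v # vs) @ ws) = - Pf e (us @ v # x # vs @ ws)"
    using Cons.prems Pf_swap_adjacent[of us "vs @ ws" e x v] by simp
  also have "\<dots> = - ((-1) ^ length vs * Pf e (us @ v # vs @ x # ws))"
    using Cons.IH[of "us @ [v]"] Cons.prems by simp
  finally show ?case by simp
qed simp

text \<open>Once the symbol is moved to the front, the row expansion is linear in its entries
  against the remaining symbols.\<close>

lemma Pf_add:
  assumes skew: "\<And>x y. e x y = - e y x" and odd: "odd (length (us @ vs))"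
    and add: "\<And>w. w \<in> set (us @ vs) \<Longrightarrow> e z w = e x w + e y w"
  shows "Pf e (us @ z # vs) = Pf e (us @ x # vs) + Pf e (us @ y # vs)"
proof -
  let ?s = "\<lambda>w. \<Sum>j<length (us @ vs). (-1) ^ j * e w ((us @ vs) ! j) * Pf e (remove_nth j (us @ vs))"
  have 1: "Pf e (us @ w # vs) = (-1) ^ length us * ?s w" for w
  proof -
    have "Pf e ([] @ w # us @ vs) = (-1) ^ length us * Pf e ([] @ us @ w # vs)"
      using odd by (intro Pf_move) auto
    then have "Pf e (us @ w # vs) = (-1) ^ length us * Pf e (w # us @ vs)"
      by (simp flip: mult.assoc power_mult_distrib)
    then show ?thesis using Pf_Cons[of e, OF skew odd, of w] by simp
  qed
  have "?s z = ?s x + ?s y"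
    unfolding sum.distrib[symmetric]
    by (intro sum.cong refl) (simp only: lessThan_iff add[OF nth_mem] distrib_left distrib_right)
  then show ?thesis unfolding 1 by (simp only: distrib_left)
qed

text \<open>Expanding both sums along their first symbols gives the same double sum with opposite signs.\<close>

lemma Pf_quadratic_relation:
  assumes skew: "\<And>x y. e x y = - e y x" and "odd (length xs)" "odd (length ys)"
  shows "(\<Sum>i<length xs. (-1) ^ i * Pf e (remove_nth i xs) * Pf e (xs ! i # ys)) +
    (\<Sum>j<length ys. (-1) ^ j * Pf e (ys ! j # xs) * Pf e (remove_nth j ys)) = 0"
proof -
  let ?f = "\<lambda>i j. (-1) ^ i * (-1) ^ j * e (xs ! i) (ys ! j) * Pf e (remove_nth i xs) * Pf e (remove_nth j ys)"
  have "(\<Sum>i<length xs. (-1) ^ i * Pf e (remove_nth i xs) * Pf e (xs ! i # ys)) =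
    (\<Sum>i<length xs. \<Sum>j<length ys. ?f i j)"
    using Pf_Cons[OF skew assms(3)] by (simp add: sum_distrib_left mult_ac)
  moreover have "(\<Sum>j<length ys. (-1) ^ j * Pf e (ys ! j # xs) * Pf e (remove_nth j ys)) =
    (\<Sum>j<length ys. \<Sum>i<length xs. - ?f i j)"
    unfolding Pf_Cons[OF skew assms(2)] sum_distrib_left sum_distrib_right
  proof (intro sum.cong refl)
    fix i j
    show "(-1) ^ j * ((-1) ^ i * e (ys ! j) (xs ! i) * Pf e (remove_nth i xs)) * Pf e (remove_nth j ys) = - ?f i j"
      by (subst skew) (simp add: mult_ac)
  qed
  ultimately show ?thesis
    by (subst (asm) (2) sum.swap) (simp add: sum_negf)
qed

text \<open>This is the quadratic relation for the lists \<open>t # u # v # S @ [w]\<close> and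
  \<open>S\<close>. A symbol of \<open>S\<close> added to a list that already contains it gives
  zero, so only the four terms of \<open>t\<close>, \<open>u\<close>, \<open>v\<close>,
  \<open>w\<close> survive.\<close>

lemma Pf_Plucker_odd:
  assumes skew: "\<And>x y. e x y = - e y x" and S: "odd (length S)"
  shows "Pf e (u # v # S @ [w]) * Pf e (t # S) - Pf e (t # v # S @ [w]) * Pf e (u # S)
    + Pf e (t # u # S @ [w]) * Pf e (v # S) + Pf e (t # u # v # S) * Pf e (w # S) = 0"
proof -
  let ?f = "\<lambda>i. (-1) ^ i * Pf e (remove_nth i (t # u # v # S @ [w])) * Pf e ((t # u # v # S @ [w]) ! i # S)"
  have 1: "Pf e (S ! i # S) = 0" if "i < length S" for i
    using that S by (intro Pf_not_distinct) auto
  have 2: "Pf e (S ! i # t # u # v # S @ [w]) = 0" if "i < length S" for i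
    using that S by (intro Pf_not_distinct) auto
  have split: "(\<Sum>i<Suc (Suc (Suc (Suc n))). f i) =
      f 0 + f (Suc 0) + f (Suc (Suc 0)) + (\<Sum>i<n. f (Suc (Suc (Suc i)))) + f (Suc (Suc (Suc n)))"
    for f :: "nat \<Rightarrow> real" and n
    by (induction n) simp_all
  have "(\<Sum>i<Suc (Suc (Suc (Suc (length S)))). ?f i) = 0"
    using Pf_quadratic_relation[of e, OF skew _ S, of "t # u # v # S @ [w]"] S 2 by simp
  moreover have "(\<Sum>i<length S. ?f (Suc (Suc (Suc i)))) = 0"
    by (rule sum.neutral) (simp add: nth_append 1)
  ultimately show ?thesis
    unfolding split using S by simp
qed

text \<open>Here \<open>t\<close> moves to the second list to keep both lengths odd. The first sum
  then leaves the terms of \<open>u\<close>, \<open>v\<close>, \<open>w\<close>, and the second sum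
  leaves that of \<open>t\<close>.\<close>

lemma Pf_Plucker_even:
  assumes skew: "\<And>x y. e x y = - e y x" and S: "even (length S)"
  shows "Pf e (v # S @ [w]) * Pf e (u # t # S) - Pf e (u # S @ [w]) * Pf e (v # t # S)
    + Pf e (u # v # S) * Pf e (w # t # S) + Pf e (t # u # v # S @ [w]) * Pf e S = 0"
proof -
  let ?xs = "u # v # S @ [w]"
  let ?f = "\<lambda>i. (-1) ^ i * Pf e (remove_nth i ?xs) * Pf e (?xs ! i # t # S)"
  let ?g = "\<lambda>i. (-1) ^ i * Pf e ((t # S) ! i # ?xs) * Pf e (remove_nth i (t # S))"
  have 1: "Pf e (S ! i # t # S) = 0" if "i < length S" for i
    using that S by (intro Pf_not_distinct) auto
  have 2: "Pf e (S ! i # ?xs) = 0" if "i < length S" for i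
    using that S by (intro Pf_not_distinct) auto
  have split: "(\<Sum>i<Suc (Suc (Suc n)). f i) =
      f 0 + f (Suc 0) + (\<Sum>i<n. f (Suc (Suc i))) + f (Suc (Suc n))"
    for f :: "nat \<Rightarrow> real" and n
    by (induction n) simp_all
  have "(\<Sum>i<Suc (Suc (Suc (length S))). ?f i) + (\<Sum>i<Suc (length S). ?g i) = 0"
    using Pf_quadratic_relation[of e, OF skew, of ?xs "t # S"] S by simp
  moreover have "(\<Sum>i<length S. ?f (Suc (Suc i))) = 0"
    by (rule sum.neutral) (simp add: nth_append 1)
  moreover have "(\<Sum>i<Suc (length S). ?g i) = ?g 0"
    unfolding sum.lessThan_Suc_shift by (simp add: 2)
  ultimately show ?thesis
    unfolding split using S by simp
qed

section \<open>Moments\<close>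

text \<open>Fubini is applied to a Borel function equal to \<open>f\<close> almost everywhere.
  Measurability of the swapped function is assumed separately; for the moments,
  \<open>mu_skew\<close> obtains it from the skew-symmetry of the kernel.\<close>

lemma integral_lebesgue_swap:
  fixes f :: "real \<times> real \<Rightarrow> real"
  assumes f: "f \<in> borel_measurable lebesgue" and g: "(\<lambda>(x, y). f (y, x)) \<in> borel_measurable lebesgue"
  shows "(\<integral>(x, y). f (y, x) \<partial>lebesgue) = integral\<^sup>L lebesgue f"
proof -
  obtain f' where f': "f' \<in> borel_measurable lborel" and ae: "AE p in lborel. f p = f' p"
    using completion_ex_borel_measurable_real[OF f] by blast
  have swap: "lborel = distr lborel lborel (\<lambda>(x :: real, y :: real). (y, x))"
    using lborel_pair.distr_pair_swap by (simp add: lborel_prod)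
  have meas: "(\<lambda>(x :: real, y :: real). (y, x)) \<in> lborel \<rightarrow>\<^sub>M lborel"
    using measurable_pair_swap'[of "lborel :: real measure" "lborel :: real measure"]
    by (simp add: lborel_prod)
  have g': "(\<lambda>(x, y). f' (y, x)) \<in> borel_measurable lborel"
    using measurable_compose[OF meas f'] by (simp add: split_beta')
  \<comment> \<open>The exchange of coordinates preserves \<open>lborel\<close>, so
    almost-everywhere equality carries over to the swapped functions.\<close>
  have "AE p in distr lborel lborel (\<lambda>(x :: real, y :: real). (y, x)). f p = f' p"
    using ae swap by metis
  from AE_distrD[OF meas this]
  have "AE p in lborel. (case p of (x, y) \<Rightarrow> f (y, x)) = (case p of (x, y) \<Rightarrow> f' (y, x))"
    by (simp add: split_beta')
  then have "(\<integral>(x, y). f (y, x) \<partial>lebesgue) = (\<integral>(x, y). f' (y, x) \<partial>lebesgue)"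
    by (intro integral_cong_AE g measurable_completion g' AE_completion)
  also have "\<dots> = (\<integral>(x, y). f' (y, x) \<partial>lborel)"
    by (rule integral_completion[OF g'])
  also have "\<dots> = integral\<^sup>L lborel f'"
    using lborel_pair.integral_product_swap[of f'] f' by (simp add: lborel_prod)
  also have "\<dots> = integral\<^sup>L lebesgue f'"
    by (rule integral_completion[OF f', symmetric])
  also have "\<dots> = integral\<^sup>L lebesgue f"
    using ae by (intro integral_cong_AE f measurable_completion f' AE_completion) (auto elim: eventually_mono)
  finally show ?thesis .
qed

lemma AE_lebesgue_coordinates_nonzero:
  "AE p in lebesgue. fst p \<noteq> (0::real) \<and> snd p \<noteq> (0::real)"
proof -
  have "negligible {p :: real \<times> real. p \<bullet> (1, 0) = 0}" "negligible {p :: real \<times> real. p \<bullet> (0, 1) = 0}"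
    by (intro negligible_standard_hyperplane, simp add: Basis_prod_def)+
  then have "negligible ({p :: real \<times> real. p \<bullet> (1, 0) = 0} \<union> {p. p \<bullet> (0, 1) = 0})"
    by (rule negligible_Un)
  then show ?thesis
    unfolding negligible_iff_null_sets by (rule AE_I') auto
qed

text \<open>At \<open>x = 0\<close> and \<open>m = -1\<close> the left side is 0 and the right side
  is 1. The moment identities below therefore compare integrands only almost everywhere.\<close>

lemma powi_times_one_plus:
  fixes x :: real
  assumes "x \<noteq> 0"
  shows "x powi m * (1 + x) = x powi m + x powi (m + 1)"
  using assms by (simp add: distrib_left power_int_add_1)

text \<open>One more factor \<open>1 + x\<close> adds a copy of the integrand with exponent
  \<open>k - i + 1\<close>, which is the integrand of index \<open>i - 1\<close>.\<close>

lemma beta_Suc: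
  assumes "\<And>i k l. integrable lebesgue (beta_integrand \<rho> i k l)"
  shows "beta \<rho> i k (Suc l) = beta \<rho> i k l + beta \<rho> (i - 1) k l"
proof -
  have "beta_integrand \<rho> i k (Suc l) x = beta_integrand \<rho> i k l x + beta_integrand \<rho> (i - 1) k l x"
    if "x \<noteq> 0" for x
  proof -
    have "beta_integrand \<rho> i k (Suc l) x = x powi (k - i) * (1 + x) * (1 + x) ^ l * \<rho> x"
      by (simp add: beta_integrand_def)
    then show ?thesis
      unfolding powi_times_one_plus[OF that] by (simp add: beta_integrand_def algebra_simps)
  qed
  moreover have "AE x in lebesgue. x \<noteq> (0::real)"
    using negligible_sing[of 0] unfolding negligible_iff_null_sets by (rule AE_I') auto
  ultimately have "AE x in lebesgue. beta_integrand \<rho> i k (Suc l) x =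
      beta_integrand \<rho> i k l x + beta_integrand \<rho> (i - 1) k l x"
    by (auto elim: eventually_mono)
  then have "beta \<rho> i k (Suc l) =
      (\<integral>x. beta_integrand \<rho> i k l x + beta_integrand \<rho> (i - 1) k l x \<partial>lebesgue)"
    unfolding beta_def using assms by (intro integral_cong_AE borel_measurable_add) auto
  then show ?thesis
    using assms by (simp add: beta_def)
qed

text \<open>The splitting used for \<open>beta\<close> happens in both variables at once, which
  gives four terms.\<close>

lemma mu_Suc:
  assumes "\<And>i j k l. integrable lebesgue (mu_integrand \<omega> \<rho> i j k l)"
  shows "mu \<omega> \<rho> i j k (Suc l) =
    mu \<omega> \<rho> i j k l + mu \<omega> \<rho> (i - 1) j k l + mu \<omega> \<rho> i (j - 1) k l + mu \<omega> \<rho> (i - 1) (j - 1) k l"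
proof -
  let ?m = "\<lambda>i j. mu_integrand \<omega> \<rho> i j k l"
  have "mu_integrand \<omega> \<rho> i j k (Suc l) p = ?m i j p + ?m (i - 1) j p + ?m i (j - 1) p + ?m (i - 1) (j - 1) p"
    if p: "fst p \<noteq> 0 \<and> snd p \<noteq> 0" for p
  proof -
    obtain x y where xy: "p = (x, y)" by (cases p)
    with p have nz: "x \<noteq> 0" "y \<noteq> 0" by auto
    have "mu_integrand \<omega> \<rho> i j k (Suc l) p = (x powi (k - i) * (1 + x)) * (y powi (k - j) * (1 + y)) *
        ((1 + x) ^ l * (1 + y) ^ l * \<omega> x y * \<rho> x * \<rho> y)"
      by (simp add: mu_integrand_def xy)
    also have "\<dots> = (x powi (k - i) + x powi (k - i + 1)) * (y powi (k - j) + y powi (k - j + 1)) *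
        ((1 + x) ^ l * (1 + y) ^ l * \<omega> x y * \<rho> x * \<rho> y)"
      by (simp only: powi_times_one_plus[OF nz(1)] powi_times_one_plus[OF nz(2)])
    also have "\<dots> = ?m i j p + ?m (i - 1) j p + ?m i (j - 1) p + ?m (i - 1) (j - 1) p"
      by (simp add: mu_integrand_def xy diff_diff_eq2 add_diff_eq[symmetric] add.commute) (simp add: algebra_simps)
    finally show ?thesis .
  qed
  then have "AE p in lebesgue. mu_integrand \<omega> \<rho> i j k (Suc l) p =
      ?m i j p + ?m (i - 1) j p + ?m i (j - 1) p + ?m (i - 1) (j - 1) p"
    using AE_lebesgue_coordinates_nonzero by (auto elim: eventually_mono)
  then have "mu \<omega> \<rho> i j k (Suc l) =
      (\<integral>p. ?m i j p + ?m (i - 1) j p + ?m i (j - 1) p + ?m (i - 1) (j - 1) p \<partial>lebesgue)"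
    unfolding mu_def using assms by (intro integral_cong_AE borel_measurable_add) auto
  then show ?thesis
    using assms by (simp add: mu_def)
qed

lemma mu_skew:
  assumes skew: "\<And>x y. \<omega> x y = - \<omega> y x"
    and int: "\<And>i j k l. integrable lebesgue (mu_integrand \<omega> \<rho> i j k l)"
  shows "mu \<omega> \<rho> i j k l = - mu \<omega> \<rho> j i k l"
proof -
  let ?f = "mu_integrand \<omega> \<rho> j i k l"
  have e: "(\<lambda>(x, y). ?f (y, x)) = (\<lambda>p. - mu_integrand \<omega> \<rho> i j k l p)"
  proof
    fix p :: "real \<times> real"
    show "(case p of (x, y) \<Rightarrow> ?f (y, x)) = - mu_integrand \<omega> \<rho> i j k l p"
      using skew[of "fst p" "snd p"] by (simp add: mu_integrand_def split_beta mult_ac)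
  qed
  have "(\<integral>(x, y). ?f (y, x) \<partial>lebesgue) = integral\<^sup>L lebesgue ?f"
    using int by (intro integral_lebesgue_swap) (auto simp: e)
  then show ?thesis
    unfolding e mu_def by simp
qed

section \<open>The recurrence\<close>

text \<open>Only one term of the row expansion survives. This will apply to \<open>Alt\<close>,
  which pairs to zero with \<open>Wt\<close> and with all the sums.\<close>

lemma Pf_Cons_single:
  assumes skew: "\<And>x y. e x y = - e y x" and odd: "odd (length (us @ y # vs))"
    and 0: "\<And>w. w \<in> set (us @ vs) \<Longrightarrow> e x w = 0"
  shows "Pf e (x # us @ y # vs) = (-1) ^ length us * e x y * Pf e (us @ vs)"
proof -
  let ?f = "\<lambda>j. (-1) ^ j * e x ((us @ y # vs) ! j) * Pf e (remove_nth j (us @ y # vs))"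
  have "?f j = 0" if "j < length (us @ y # vs)" "j \<noteq> length us" for j
  proof -
    have "(us @ y # vs) ! j \<in> set (us @ vs)"
      using that by (auto simp: nth_append nth_Cons split: nat.splits)
    then show ?thesis by (simp only: 0)
  qed
  then have "(\<Sum>j<length (us @ y # vs). ?f j) = (\<Sum>j\<in>{length us}. ?f j)"
    by (intro sum.mono_neutral_right) auto
  then show ?thesis
    unfolding Pf_Cons[of e, OF skew odd] by (simp add: remove_nth_def)
qed

text \<open>
  \<open>Mom i\<close> and \<open>Wt\<close> stand for \<open>i\<close> and \<open>d\<^sub>0\<close>; \<open>Sum i\<close> is the formal sum
  \<open>Mom i + Mom (Suc i)\<close>, and \<open>Alt\<close> is an auxiliary symbol that pairs to zero with every such sum.
\<close>

datatype symbol = Alt | Wt | Mom nat | Sum nat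

fun entry :: "(nat \<Rightarrow> nat \<Rightarrow> real) \<Rightarrow> (nat \<Rightarrow> real) \<Rightarrow> symbol \<Rightarrow> symbol \<Rightarrow> real" where
  "entry m b (Mom i) (Mom j) = m i j"
| "entry m b (Mom i) (Sum j) = m i j + m i (Suc j)"
| "entry m b (Sum i) (Mom j) = m i j + m (Suc i) j"
| "entry m b (Sum i) (Sum j) = m i j + m i (Suc j) + m (Suc i) j + m (Suc i) (Suc j)"
| "entry m b Wt (Mom i) = b i"
| "entry m b Wt (Sum i) = b i + b (Suc i)"
| "entry m b (Mom i) Wt = - b i"
| "entry m b (Sum i) Wt = - (b i + b (Suc i))"
| "entry m b Alt (Mom i) = (-1) ^ i"
| "entry m b (Mom i) Alt = - ((-1) ^ i)"
| "entry m b _ _ = 0"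

lemma entry_skew:
  assumes "\<And>i j. m i j = - m j i"
  shows "entry m b x y = - entry m b y x"
proof (cases x; cases y)
  fix i j assume "x = Mom i" "y = Mom j"
  then show ?thesis using assms[of i j] by simp
next
  fix i j assume "x = Mom i" "y = Sum j"
  then show ?thesis using assms[of i j] assms[of i "Suc j"] by simp
next
  fix i j assume "x = Sum i" "y = Mom j"
  then show ?thesis using assms[of i j] assms[of "Suc i" j] by simp
next
  fix i j assume "x = Sum i" "y = Sum j"
  then show ?thesis
    using assms[of i j] assms[of i "Suc j"] assms[of "Suc i" j] assms[of "Suc i" "Suc j"] by simp
qed simp_all

lemma entry_Sum: "entry m b (Sum i) w = entry m b (Mom i) w + entry m b (Mom (Suc i)) w"
  by (cases w) simp_all

text \<open>The symbol for \<open>d\<^sub>0\<close> precedes an odd number of indices, so that the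
  list always has even length.\<close>

definition parity_prefix :: "nat \<Rightarrow> symbol list" where
  "parity_prefix n = (if even n then [] else [Wt])"

text \<open>With the moments at \<open>(k, l)\<close> for \<open>m\<close> and \<open>b\<close>,
  this is the \<tau> of size \<open>n\<close> at \<open>(k - a, l)\<close>.\<close>

definition mom_Pf :: "(nat \<Rightarrow> nat \<Rightarrow> real) \<Rightarrow> (nat \<Rightarrow> real) \<Rightarrow> nat \<Rightarrow> nat \<Rightarrow> real" where
  "mom_Pf m b n a = Pf (entry m b) (parity_prefix n @ map Mom [a..<n + a])"

text \<open>With the moments at \<open>(k, l)\<close> for \<open>m\<close> and \<open>b\<close>,
  this is the \<tau> of size \<open>n\<close> at \<open>(k - a - 1, l + 1)\<close>.\<close>

definition sum_Pf :: "(nat \<Rightarrow> nat \<Rightarrow> real) \<Rightarrow> (nat \<Rightarrow> real) \<Rightarrow> nat \<Rightarrow> nat \<Rightarrow> real" where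
  "sum_Pf m b n a = Pf (entry m b) (parity_prefix n @ map Sum [a..<n + a])"

context
  fixes m :: "nat \<Rightarrow> nat \<Rightarrow> real" and b :: "nat \<Rightarrow> real"
  assumes skew: "\<And>i j. m i j = - m j i"
begin

abbreviation (input) "P \<equiv> Pf (entry m b)"

text \<open>Adding to the last index its predecessor changes nothing, because the extra Pfaffian
  repeats a symbol. The finished sum then joins \<open>vs\<close>, and the induction proceeds from
  right to left.\<close>

lemma Pf_consecutive_sums:
  assumes "even (length us + Suc n + length vs)"
  shows "P (us @ map Mom [a..<Suc n + a] @ vs) = P (us @ Mom a # map Sum [a..<n + a] @ vs)"
  using assms
proof (induction n arbitrary: vs)
  case (Suc n)
  let ?us = "us @ map Mom [a..<Suc n + a]"
  have "P (?us @ Sum (n + a) # vs) = P (?us @ Mom (n + a) # vs) + P (?us @ Mom (Suc (n + a)) # vs)"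
    using Suc.prems by (intro Pf_add entry_skew skew entry_Sum) auto
  moreover have "P (?us @ Mom (n + a) # vs) = 0"
    using Suc.prems by (intro Pf_not_distinct) auto
  ultimately have "P (us @ map Mom [a..<Suc (Suc n) + a] @ vs) =
      P (us @ map Mom [a..<Suc n + a] @ Sum (n + a) # vs)"
    by simp
  also have "\<dots> = P (us @ Mom a # map Sum [a..<n + a] @ Sum (n + a) # vs)"
    using Suc.prems by (intro Suc.IH) auto
  finally show ?case by simp
qed simp

text \<open>After the indices are replaced by sums, \<open>Alt\<close> has a nonzero entry only with
  the leading \<open>Mom a\<close>. Its entry gives \<open>(-1) ^ a\<close>, and its position behind
  the prefix gives \<open>(-1) ^ n\<close>.\<close>

lemma Pf_Alt:
  "P (Alt # parity_prefix n @ map Mom [a..<Suc n + a]) = (-1) ^ (n + a) * sum_Pf m b n a"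
proof -
  let ?p = "parity_prefix n"
  have "P ((Alt # ?p) @ map Mom [a..<Suc n + a] @ []) =
      P ((Alt # ?p) @ Mom a # map Sum [a..<n + a] @ [])"
    by (rule Pf_consecutive_sums) (simp add: parity_prefix_def)
  also have "\<dots> = (-1) ^ length ?p * entry m b Alt (Mom a) * P (?p @ map Sum [a..<n + a])"
    using Pf_Cons_single[of "entry m b" ?p "Mom a" "map Sum [a..<n + a]" Alt, OF entry_skew[OF skew]]
    by (force simp: parity_prefix_def)
  also have "(-1 :: real) ^ length ?p = (-1) ^ n"
    by (simp add: parity_prefix_def)
  finally show ?thesis
    by (simp add: sum_Pf_def power_add)
qed

text \<open>In the Pluecker relation with common part \<open>S\<close> and free symbols
  \<open>Wt\<close>, \<open>Alt\<close>, \<open>Mom 0\<close>, \<open>w\<close>, the factors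
  containing \<open>Alt\<close> become values of \<open>sum_Pf\<close> and the others values of
  \<open>mom_Pf\<close>. The parity of \<open>n\<close> decides which of the two forms
  applies.\<close>

lemma mom_sum_Pf_relation:
  "mom_Pf m b (n + 2) 0 * (if n = 0 then 0 else sum_Pf m b (n - 1) 1) =
     mom_Pf m b (n + 1) 0 * sum_Pf m b n 1 - sum_Pf m b (n + 1) 0 * mom_Pf m b n 1
     + mom_Pf m b (n + 1) 1 * sum_Pf m b n 0"
proof -
  note sk = entry_skew[of m b, OF skew]
  define S where "S = map Mom [1..<n + 1]"
  define w where "w = Mom (Suc n)"
  have len: "length S = n"
    by (simp add: S_def)
  have S: "S = map Mom [1..<n + 1]" "S @ [w] = map Mom [1..<Suc n + 1]"
    "Mom 0 # S = map Mom [0..<Suc n]" "Mom 0 # S @ [w] = map Mom [0..<Suc (Suc n)]"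
    by (simp_all add: S_def w_def upt_conv_Cons flip: map_Suc_upt)
  show ?thesis
  proof (cases "even n")
    case True
    have "P (Mom 0 # S @ [w]) = mom_Pf m b (n + 2) 0" "P (Wt # S @ [w]) = mom_Pf m b (n + 1) 1"
      "P (Wt # Mom 0 # S) = mom_Pf m b (n + 1) 0" "P S = mom_Pf m b n 1"
      using True by (simp add: S(4) mom_Pf_def parity_prefix_def del: upt_Suc,
          simp add: S(2) mom_Pf_def parity_prefix_def del: upt_Suc,
          simp add: S(3) mom_Pf_def parity_prefix_def del: upt_Suc,
          simp add: S(1) mom_Pf_def parity_prefix_def del: upt_Suc)
    \<comment> \<open>For \<open>n = 0\<close> the left side is the single entry of
      \<open>Wt\<close> with \<open>Alt\<close>, which is 0 in accordance with the convention for
      size -1.\<close>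
    moreover have "P (Wt # Alt # S) = - (if n = 0 then 0 else sum_Pf m b (n - 1) 1)"
    proof (cases n)
      case 0
      then show ?thesis
        using Pf_Cons_single[of "entry m b" "[]" Alt "[]" Wt, OF sk] len by simp
    next
      case (Suc n')
      then show ?thesis
        using Pf_swap_adjacent[of "[]" S "entry m b" Wt Alt] Pf_Alt[of n' 1] True len
        by (simp add: S(1) parity_prefix_def del: upt_Suc)
    qed
    moreover have "P (Mom 0 # Alt # S) = - sum_Pf m b n 0"
      using Pf_swap_adjacent[of "[]" S "entry m b" Alt "Mom 0"] Pf_Alt[of n 0] True len
      by (simp add: S(3) parity_prefix_def del: upt_Suc)
    \<comment> \<open>Moving \<open>w\<close> past the \<open>n + 1\<close> symbols of
      \<open>Alt # S\<close> costs a sign that cancels the one in \<open>Pf_Alt\<close>.\<close>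
    moreover have "P (w # Alt # S) = sum_Pf m b n 1"
      using Pf_move[of "[]" w "Alt # S" "[]" "entry m b"] Pf_Alt[of n 1] True len
      by (simp add: S(2) parity_prefix_def del: upt_Suc)
    moreover have "P (Alt # Wt # Mom 0 # S @ [w]) = - sum_Pf m b (n + 1) 0"
      using Pf_Alt[of "n + 1" 0] True by (simp add: S(4) parity_prefix_def del: upt_Suc)
    ultimately show ?thesis
      using Pf_Plucker_even[of "entry m b" S "Mom 0" w Wt Alt, OF sk] True len by simp
  next
    case False
    then obtain n' where n: "n = Suc n'" by (cases n) auto
    have "P (Wt # Mom 0 # S @ [w]) = mom_Pf m b (n + 2) 0" "P (Wt # S) = mom_Pf m b n 1"
      "P (Mom 0 # S) = mom_Pf m b (n + 1) 0"
      using False by (simp add: S(4) mom_Pf_def parity_prefix_def del: upt_Suc,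
          simp add: S(1) mom_Pf_def parity_prefix_def del: upt_Suc,
          simp add: S(3) mom_Pf_def parity_prefix_def del: upt_Suc)
    moreover have "P (Alt # S) = - (if n = 0 then 0 else sum_Pf m b (n - 1) 1)"
      using Pf_Alt[of n' 1] False n by (simp add: S(1) parity_prefix_def del: upt_Suc)
    moreover have "P (Alt # Mom 0 # S @ [w]) = sum_Pf m b (n + 1) 0"
      using Pf_Alt[of "n + 1" 0] False by (simp add: S(4) parity_prefix_def del: upt_Suc)
    moreover have "P (Alt # Wt # S @ [w]) = sum_Pf m b n 1"
      using Pf_Alt[of n 1] False by (simp add: S(2) parity_prefix_def del: upt_Suc)
    moreover have "P (Alt # Wt # Mom 0 # S) = - sum_Pf m b n 0"
      using Pf_Alt[of n 0] False by (simp add: S(3) parity_prefix_def del: upt_Suc)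
    moreover have "P (w # S) = - mom_Pf m b (n + 1) 1"
      using Pf_move[of "[]" w S "[]" "entry m b"] False len
      by (simp add: S(2) mom_Pf_def parity_prefix_def del: upt_Suc)
    ultimately show ?thesis
      using Pf_Plucker_odd[of "entry m b" S Wt "Mom 0" w Alt, OF sk] False len
      by (simp add: n algebra_simps)
  qed
qed

end

section \<open>The values of tau as Pfaffians in the formal symbols\<close>

lemma upto_eq_map_upt: "[0..int n - 1] = map int [0..<n]"
  by (induction n) (simp_all add: upto_rec2)

lemma tau_eq_Pf_entry:
  assumes mu: "\<And>i j. mu \<omega> \<rho> (int i) (int j) k l = entry m b (f i) (f j)"
    and beta: "\<And>i. beta \<rho> (int i) k l = entry m b Wt (f i)"
      "\<And>i. - beta \<rho> (int i) k l = entry m b (f i) Wt"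
  shows "tau \<omega> \<rho> (int n) k l = Pf (entry m b) (parity_prefix n @ map f [0..<n])"
proof -
  \<comment> \<open>Both Pfaffians are images of one list, in which \<open>None\<close> marks the
    place of \<open>d\<^sub>0\<close>; it then suffices to compare entries.\<close>
  let ?L = "(if even n then [] else [None]) @ map Some [0..<n]"
  let ?g = "case_option D0 (\<lambda>i. Idx (int i))" and ?h = "case_option Wt f"
  have "tau \<omega> \<rho> (int n) k l = Pf (pf_entry \<omega> \<rho> k l) (map ?g ?L)"
    by (simp add: tau_def upto_eq_map_upt comp_def)
  also have "\<dots> = Pf (entry m b) (map ?h ?L)"
    unfolding Pf_map by (rule Pf_cong) (auto simp: mu beta(1) simp flip: beta(2) split: option.splits)
  also have "map ?h ?L = parity_prefix n @ map f [0..<n]"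
    by (simp add: parity_prefix_def comp_def)
  finally show ?thesis .
qed

lemma mu_shift: "mu \<omega> \<rho> i j (k - s) l = mu \<omega> \<rho> (i + s) (j + s) k l"
  by (simp add: mu_def mu_integrand_def diff_diff_eq add.commute)

lemma beta_shift: "beta \<rho> i (k - s) l = beta \<rho> (i + s) k l"
  by (simp add: beta_def beta_integrand_def diff_diff_eq add.commute)

lemma map_comp_add_upt: "map (\<lambda>i. f (i + a)) [0..<n] = map f [a..<n + a]"
  by (simp flip: map_add_upt)

lemma tau_eq_mom_Pf:
  "tau \<omega> \<rho> (int n) (k - int s) l =
    mom_Pf (\<lambda>i j. mu \<omega> \<rho> (int i) (int j) k l) (\<lambda>i. beta \<rho> (int i) k l) n s"
  unfolding mom_Pf_def map_comp_add_upt[symmetric]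
  by (rule tau_eq_Pf_entry) (simp_all add: mu_shift beta_shift)

text \<open>Shifting to \<open>k\<close> turns index \<open>i\<close> into \<open>i + s + 1\<close>.
  Lowering \<open>l + 1\<close> to \<open>l\<close> then adds its predecessor \<open>i + s\<close>,
  and together they form \<open>Sum (i + s)\<close>.\<close>

lemma tau_Suc_eq_sum_Pf:
  assumes "\<And>i j k l. integrable lebesgue (mu_integrand \<omega> \<rho> i j k l)"
    and "\<And>i k l. integrable lebesgue (beta_integrand \<rho> i k l)"
  shows "tau \<omega> \<rho> (int n) (k - int (Suc s)) (Suc l) =
    sum_Pf (\<lambda>i j. mu \<omega> \<rho> (int i) (int j) k l) (\<lambda>i. beta \<rho> (int i) k l) n s"
  unfolding sum_Pf_def map_comp_add_upt[symmetric]
  by (rule tau_eq_Pf_entry)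
     (simp_all add: mu_shift beta_shift mu_Suc[OF assms(1)] beta_Suc[OF assms(2)] algebra_simps)

theorem mainTheorem11:
  fixes \<omega> :: "real \<Rightarrow> real \<Rightarrow> real" and \<rho> :: "real \<Rightarrow> real"
  assumes skew: "\<And>x y. \<omega> x y = - \<omega> y x"
    and mu_integrable:
      "\<And>(i::int) (j::int) (k::int) (l::nat). integrable lebesgue (mu_integrand \<omega> \<rho> i j k l)"
    and beta_integrable:
      "\<And>(i::int) (k::int) (l::nat). integrable lebesgue (beta_integrand \<rho> i k l)"
    and nonzero:
      "\<And>(n::int) (k::int) (l::nat). n \<ge> 0 \<Longrightarrow> k \<ge> 0 \<Longrightarrow> tau \<omega> \<rho> n k l \<noteq> 0"
  shows "\<forall>(n::int) (k::int) (l::nat). n \<ge> 0 \<longrightarrow> k \<ge> 2 \<longrightarrow>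
           tau \<omega> \<rho> (n + 2) k l * tau \<omega> \<rho> (n - 1) (k - 2) (l + 1) =
             tau \<omega> \<rho> (n + 1) k l * tau \<omega> \<rho> n (k - 2) (l + 1)
             - tau \<omega> \<rho> (n + 1) (k - 1) (l + 1) * tau \<omega> \<rho> n (k - 1) l
             + tau \<omega> \<rho> (n + 1) (k - 1) l * tau \<omega> \<rho> n (k - 1) (l + 1)"
proof (intro allI impI)
  fix n k :: int and l :: nat
  assume "n \<ge> 0"
  then obtain N where n: "n = int N" using nonneg_eq_int by blast
  \<comment> \<open>All eight values of \<tau> are expressed through the moments at the single base
    point \<open>(k, l)\<close>.\<close>
  let ?m = "\<lambda>i j. mu \<omega> \<rho> (int i) (int j) k l" and ?b = "\<lambda>i. beta \<rho> (int i) k l"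
  note mom = tau_eq_mom_Pf[of \<omega> \<rho> _ k _ l]
  note sm = tau_Suc_eq_sum_Pf[of \<omega> \<rho> _ k _ l, OF mu_integrable beta_integrable]
  have 1: "tau \<omega> \<rho> (n + 2) k l = mom_Pf ?m ?b (N + 2) 0"
    "tau \<omega> \<rho> (n + 1) k l = mom_Pf ?m ?b (N + 1) 0"
    "tau \<omega> \<rho> (n + 1) (k - 1) l = mom_Pf ?m ?b (N + 1) 1"
    "tau \<omega> \<rho> n (k - 1) l = mom_Pf ?m ?b N 1"
    using mom[of "N + 2" 0] mom[of "N + 1" 0] mom[of "N + 1" 1] mom[of N 1]
    by (simp_all add: n add.commute)
  have 2: "tau \<omega> \<rho> n (k - 2) (l + 1) = sum_Pf ?m ?b N 1"
    "tau \<omega> \<rho> (n + 1) (k - 1) (l + 1) = sum_Pf ?m ?b (N + 1) 0"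
    "tau \<omega> \<rho> n (k - 1) (l + 1) = sum_Pf ?m ?b N 0"
    using sm[of N 1] sm[of "N + 1" 0] sm[of N 0]
    by (simp_all add: n add.commute)
  \<comment> \<open>The case \<open>N = 0\<close> is the convention for size -1, since
    \<open>N - 1\<close> truncates to 0 there.\<close>
  have 3: "tau \<omega> \<rho> (n - 1) (k - 2) (l + 1) = (if N = 0 then 0 else sum_Pf ?m ?b (N - 1) 1)"
    using sm[of "N - 1" 1] by (cases N) (simp_all add: n)
  show "tau \<omega> \<rho> (n + 2) k l * tau \<omega> \<rho> (n - 1) (k - 2) (l + 1) =
             tau \<omega> \<rho> (n + 1) k l * tau \<omega> \<rho> n (k - 2) (l + 1)
             - tau \<omega> \<rho> (n + 1) (k - 1) (l + 1) * tau \<omega> \<rho> n (k - 1) l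
             + tau \<omega> \<rho> (n + 1) (k - 1) l * tau \<omega> \<rho> n (k - 1) (l + 1)"
    unfolding 1 2 3 by (rule mom_sum_Pf_relation) (rule mu_skew[OF skew mu_integrable])
qed

end
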